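(* Let $A, B$ be normal $n \times n$ complex matrices. If $\operatorname{rank}(A) \leq 2$, then $AB$ is similar to $BA$.
   Context: $X^*$ denotes the conjugate transpose of a complex matrix $X$. A square complex matrix $X$ is normal if $XX^* = X^*X$. Two $n \times n$ complex matrices $X, Y$ are similar if there is an invertible $n\times n$ complex matrix $S$ with $SX = YS$. *)

theory Defs
  imports "Jordan_Normal_Form.Schur_Decomposition" "Jordan_Normal_Form.DL_Rank"
begin

definition normal_mat :: "complex mat \<Rightarrow> bool" where
  "normal_mat X \<longleftrightarrow> square_mat X \<and> X * mat_adjoint X = mat_adjoint X * X"

text \<open>The library's \<^const>\<open>mat_adjoint\<close> is the conjugate transpose.\<close>

lemma mat_adjoint_dim [simp]:
  "dim_row (mat_adjoint X) = dim_col X" "dim_col (mat_adjoint X) = dim_row X"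
  by (simp_all add: mat_adjoint_def)

lemma mat_adjoint_index:
  fixes X :: "complex mat"
  assumes "i < dim_col X" "j < dim_row X"
  shows "mat_adjoint X $$ (i, j) = cnj (X $$ (j, i))"
  using assms by (simp add: mat_adjoint_def mat_of_rows_def)

text \<open>The library's \<^const>\<open>similar_mat\<close> is similarity in the intertwining form \<open>S X = Y S\<close>.\<close>

lemma similar_mat_iff_intertwine:
  fixes X Y :: "complex mat"
  assumes X: "X \<in> carrier_mat n n" and Y: "Y \<in> carrier_mat n n"
  shows "similar_mat X Y \<longleftrightarrow> (\<exists>S \<in> carrier_mat n n. invertible_mat S \<and> S * X = Y * S)"
proof
  assume "similar_mat X Y"
  then obtain P Q where "similar_mat_wit X Y P Q"
    unfolding similar_mat_def by blast
  then have P: "P \<in> carrier_mat n n" and Q: "Q \<in> carrier_mat n n"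
    and PQ: "P * Q = 1\<^sub>m n" and QP: "Q * P = 1\<^sub>m n" and eq: "X = P * Y * Q"
    using X by (auto simp: similar_mat_wit_def Let_def)
  have "Q * X = Q * (P * (Y * Q))"
    using P Q Y by (simp add: eq)
  also have "\<dots> = (Q * P) * (Y * Q)"
    using P Q Y by (metis assoc_mult_mat mult_carrier_mat)
  also have "\<dots> = Y * Q"
    using Q Y by (simp add: QP)
  finally have "Q * X = Y * Q" .
  moreover have "invertible_mat Q"
    using P Q PQ QP unfolding invertible_mat_def inverts_mat_def by auto
  ultimately show "\<exists>S \<in> carrier_mat n n. invertible_mat S \<and> S * X = Y * S"
    using Q by blast
next
  assume "\<exists>S \<in> carrier_mat n n. invertible_mat S \<and> S * X = Y * S"
  then obtain S where S: "S \<in> carrier_mat n n" and inv: "invertible_mat S"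
    and eq: "S * X = Y * S" by blast
  from inv obtain T where ST: "S * T = 1\<^sub>m n" and TS': "T * S = 1\<^sub>m (dim_row T)"
    using S unfolding invertible_mat_def inverts_mat_def by auto
  have "dim_col T = n"
    using arg_cong[OF ST, of dim_col] by simp
  moreover have "dim_row T = n"
    using arg_cong[OF TS', of dim_col] S by simp
  ultimately have T: "T \<in> carrier_mat n n" and TS: "T * S = 1\<^sub>m n"
    using TS' by auto
  have "T * Y * S = T * (S * X)"
    using S T Y by (simp add: eq)
  also have "\<dots> = (T * S) * X"
    using S T X by (metis assoc_mult_mat)
  finally have "X = T * Y * S"
    using X by (simp add: TS)
  then have "similar_mat_wit X Y T S"
    using X Y S T ST TS by (simp add: similar_mat_wit_def Let_def)
  then show "similar_mat X Y"
    unfolding similar_mat_def by blast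
qed

end

theory Submission
  imports Defs
begin

text \<open>
Two reasons can make \<open>A B\<close> and \<open>B A\<close> similar, depending on how the range of \<open>A\<close> lies with respect to the
kernel of \<open>B\<close>. Normality enters only through the equality of the kernels of a normal matrix and its
adjoint, so that range and kernel of a normal matrix are orthogonal complements.

If the range of \<open>A\<close> meets the kernel of \<open>B\<close> only in zero, an intertwiner can be written down. The
matrix \<open>B\<close> itself satisfies \<open>B (A B) = (B A) B\<close> but may be singular. Let \<open>E\<close> be the orthogonal
projection onto the complement of the range of \<open>A\<close> and \<open>F\<close> that onto the kernel of \<open>B\<close>. Adding
\<open>E F E\<close> keeps the identity, since \<open>E A = A E = 0\<close>, and \<open>B + E F E\<close> turns out to be invertible. The
argument works for \<open>A\<close> of any rank (\<open>similar_products_if_range_meets_kernel_trivially\<close>).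

Otherwise a unit vector \<open>l\<close> of the range of \<open>A\<close> lies in the kernel of \<open>B\<close>. Because \<open>A\<close> has rank at most
two, its range is spanned by \<open>l\<close> and one vector \<open>m\<close> orthogonal to \<open>l\<close>. Since \<open>l\<close> is lost on passing
through \<open>B\<close>, both products have rank at most one:
\<open>A B = (A m) (B\<^sup>* m)\<^sup>*\<close> and \<open>B A = (B m) (A\<^sup>* m)\<^sup>*\<close>. Normality makes them vanish simultaneously, and
they have equal traces; elementary moves between matrices \<open>u v\<^sup>*\<close> of the same trace then
connect them (\<open>similar_products_if_orthonormal_range\<close>).

Throughout, the range of \<open>A\<close> may be replaced by any space of dimension at most two that contains it;
the proof works with the span of two vectors \<open>s1\<close> and \<open>s2\<close>.
\<close>

section \<open>Vectors, adjoints and normal matrices\<close>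

lemma mat_eq_if_mult_unit_vec_eq:
  fixes X Y :: "complex mat"
  assumes X: "X \<in> carrier_mat n n" and Y: "Y \<in> carrier_mat n n"
    and eq: "\<And>j. j < n \<Longrightarrow> X *\<^sub>v unit_vec n j = Y *\<^sub>v unit_vec n j"
  shows "X = Y"
proof (rule eq_matI)
  fix i j assume "i < dim_row Y" "j < dim_col Y"
  then show "X $$ (i, j) = Y $$ (i, j)"
    using arg_cong[OF eq[of j], of "\<lambda>v. v $ i"] X Y by simp
qed (use X Y in auto)

lemma zero_smult_vec:
  fixes x :: "complex vec" shows "0 \<cdot>\<^sub>v x = 0\<^sub>v (dim_vec x)"
  by auto

lemma smult_zero_vec:
  fixes a :: complex shows "a \<cdot>\<^sub>v 0\<^sub>v n = 0\<^sub>v n"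
  by auto

lemma smult_eq_zero_vec:
  fixes a :: complex
  assumes "a \<cdot>\<^sub>v x = 0\<^sub>v n" "x \<noteq> 0\<^sub>v n"
  shows "a = 0"
proof (rule ccontr)
  assume "a \<noteq> 0"
  then have "x = (1 / a) \<cdot>\<^sub>v (a \<cdot>\<^sub>v x)" by (simp add: smult_smult_assoc)
  then show False using assms by (simp add: smult_zero_vec)
qed

lemma eq_if_diff_zero_vec:
  fixes x y :: "complex vec"
  assumes "x \<in> carrier_vec n" "y \<in> carrier_vec n" "x - y = 0\<^sub>v n"
  shows "x = y"
proof (rule eq_vecI)
  fix i assume "i < dim_vec y"
  then show "x $ i = y $ i"
    using arg_cong[OF assms(3), of "\<lambda>v. v $ i"] assms(1,2) by simp
qed (use assms in auto)

lemma mat_adjoint_carrier [simp]: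
  "X \<in> carrier_mat n n \<Longrightarrow> mat_adjoint X \<in> carrier_mat n n"
  by (auto intro!: carrier_matI)

lemma mat_adjoint_adjoint [simp]:
  fixes X :: "complex mat" shows "mat_adjoint (mat_adjoint X) = X"
  by (rule eq_matI) (simp_all add: mat_adjoint_index)

lemma cscalar_prod_commute:
  fixes x y :: "complex vec"
  assumes "x \<in> carrier_vec n" "y \<in> carrier_vec n"
  shows "y \<bullet>c x = cnj (x \<bullet>c y)"
  using assms by (simp add: scalar_prod_def mult.commute)

lemma cscalar_prod_smult_left:
  fixes x y :: "complex vec"
  assumes "x \<in> carrier_vec n" "y \<in> carrier_vec n"
  shows "(a \<cdot>\<^sub>v x) \<bullet>c y = a * (x \<bullet>c y)"
  using assms by simp

lemma cscalar_prod_smult_right: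
  fixes x y :: "complex vec"
  assumes "x \<in> carrier_vec n" "y \<in> carrier_vec n"
  shows "x \<bullet>c (a \<cdot>\<^sub>v y) = cnj a * (x \<bullet>c y)"
  using assms by (simp add: conjugate_smult_vec)

lemma cscalar_prod_add_left:
  fixes x y z :: "complex vec"
  assumes "x \<in> carrier_vec n" "y \<in> carrier_vec n" "z \<in> carrier_vec n"
  shows "(x + y) \<bullet>c z = x \<bullet>c z + y \<bullet>c z"
  using assms by (simp add: add_scalar_prod_distrib)

lemma cscalar_prod_add_right:
  fixes x y z :: "complex vec"
  assumes "x \<in> carrier_vec n" "y \<in> carrier_vec n" "z \<in> carrier_vec n"
  shows "z \<bullet>c (x + y) = z \<bullet>c x + z \<bullet>c y"
  using assms by (simp add: scalar_prod_def distrib_left sum.distrib)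

lemma cscalar_prod_diff_left:
  fixes x y z :: "complex vec"
  assumes "x \<in> carrier_vec n" "y \<in> carrier_vec n" "z \<in> carrier_vec n"
  shows "(x - y) \<bullet>c z = x \<bullet>c z - y \<bullet>c z"
  using assms by (simp add: minus_scalar_prod_distrib)

lemma cscalar_prod_diff_right:
  fixes x y z :: "complex vec"
  assumes "x \<in> carrier_vec n" "y \<in> carrier_vec n" "z \<in> carrier_vec n"
  shows "z \<bullet>c (x - y) = z \<bullet>c x - z \<bullet>c y"
  using assms by (simp add: scalar_prod_def right_diff_distrib sum_subtractf)

lemmas cscalar_prod_linear =
  cscalar_prod_smult_left cscalar_prod_smult_right
  cscalar_prod_add_left cscalar_prod_add_right
  cscalar_prod_diff_left cscalar_prod_diff_right

lemma cscalar_prod_self_of_real: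
  fixes x :: "complex vec"
  assumes x: "x \<in> carrier_vec n"
  shows "x \<bullet>c x = complex_of_real (Re (x \<bullet>c x))" "0 \<le> Re (x \<bullet>c x)"
  using conjugate_square_ge_0_vec[of x] by (auto simp: less_eq_complex_def complex_eq_iff)

lemma cscalar_prod_self_pos:
  fixes x :: "complex vec"
  assumes x: "x \<in> carrier_vec n" "x \<noteq> 0\<^sub>v n"
  shows "0 < Re (x \<bullet>c x)"
  using cscalar_prod_self_of_real[OF x(1)] conjugate_square_eq_0_vec[OF x(1)] x(2)
  by (metis order_le_less of_real_0)

lemma scale_to_norm:
  fixes x :: "complex vec"
  assumes x: "x \<in> carrier_vec n" "x \<noteq> 0\<^sub>v n" and r: "0 < r"
  obtains t where "t \<noteq> 0" "(t \<cdot>\<^sub>v x) \<bullet>c (t \<cdot>\<^sub>v x) = complex_of_real r"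
proof -
  define s where "s = Re (x \<bullet>c x)"
  have s: "x \<bullet>c x = complex_of_real s" "0 < s"
    using cscalar_prod_self_of_real(1)[OF x(1)] cscalar_prod_self_pos[OF x] unfolding s_def by auto
  define t where "t = complex_of_real (sqrt (r / s))"
  have "t * cnj t = complex_of_real (r / s)"
    using r s(2) unfolding t_def by (simp flip: of_real_mult)
  then have "(t \<cdot>\<^sub>v x) \<bullet>c (t \<cdot>\<^sub>v x) = complex_of_real r"
    using x s by (simp add: cscalar_prod_linear[where n = n] mult.commute flip: mult.assoc)
  moreover have "t \<noteq> 0" using r s unfolding t_def by simp
  ultimately show ?thesis using that by blast
qed

lemma cscalar_prod_adjoint:
  fixes X :: "complex mat"
  assumes X: "X \<in> carrier_mat n n" and x: "x \<in> carrier_vec n" and y: "y \<in> carrier_vec n"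
  shows "(X *\<^sub>v x) \<bullet>c y = x \<bullet>c (mat_adjoint X *\<^sub>v y)"
proof -
  have "(X *\<^sub>v x) \<bullet>c y = (\<Sum>i<n. \<Sum>j<n. X $$ (i, j) * x $ j * cnj (y $ i))"
    using assms by (simp add: scalar_prod_def atLeast0LessThan sum_distrib_right)
  also have "\<dots> = (\<Sum>j<n. \<Sum>i<n. X $$ (i, j) * x $ j * cnj (y $ i))"
    by (rule sum.swap)
  also have "\<dots> = x \<bullet>c (mat_adjoint X *\<^sub>v y)"
    using assms by (auto simp: scalar_prod_def atLeast0LessThan sum_distrib_left
        mat_adjoint_index intro!: sum.cong)
  finally show ?thesis .
qed

lemma zero_if_orthogonal_to_all:
  fixes x :: "complex vec"
  assumes "x \<in> carrier_vec n" "\<And>y. y \<in> carrier_vec n \<Longrightarrow> y \<bullet>c x = 0"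
  shows "x = 0\<^sub>v n"
  using assms by (metis conjugate_square_eq_0_vec)

lemma normal_mat_norm:
  assumes A: "A \<in> carrier_mat n n" and nA: "normal_mat A" and x: "x \<in> carrier_vec n"
  shows "(A *\<^sub>v x) \<bullet>c (A *\<^sub>v x) = (mat_adjoint A *\<^sub>v x) \<bullet>c (mat_adjoint A *\<^sub>v x)"
proof -
  have eq: "mat_adjoint A *\<^sub>v (A *\<^sub>v x) = A *\<^sub>v (mat_adjoint A *\<^sub>v x)"
    using nA A x unfolding normal_mat_def
    by (metis assoc_mult_mat_vec mat_adjoint_carrier)
  have "(A *\<^sub>v x) \<bullet>c (A *\<^sub>v x) = x \<bullet>c (A *\<^sub>v (mat_adjoint A *\<^sub>v x))"
    using cscalar_prod_adjoint[of A n x "A *\<^sub>v x"] A x eq by simp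
  also have "\<dots> = (mat_adjoint A *\<^sub>v x) \<bullet>c (mat_adjoint A *\<^sub>v x)"
    using cscalar_prod_adjoint[of "mat_adjoint A" n x "mat_adjoint A *\<^sub>v x"] A x
    by (simp add: mult_mat_vec_carrier[where nr = n and n = n])
  finally show ?thesis .
qed

text \<open>
A normal matrix and its adjoint stretch every vector by the same factor, so they have the same
kernel. This is the only consequence of normality that the proof uses.
\<close>

lemma normal_mat_kernel:
  assumes A: "A \<in> carrier_mat n n" and nA: "normal_mat A" and x: "x \<in> carrier_vec n"
  shows "A *\<^sub>v x = 0\<^sub>v n \<longleftrightarrow> mat_adjoint A *\<^sub>v x = 0\<^sub>v n"
  using normal_mat_norm[OF assms] A x conjugate_square_eq_0_vec
  by (metis mat_adjoint_carrier mult_mat_vec_carrier)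

text \<open>
All similarities below are composed of ones obtained this way: intertwining is tested on vectors, and an injective
square matrix is invertible because its determinant does not vanish.
\<close>

lemma similar_mat_if_injective_intertwiner:
  fixes S X Y :: "complex mat"
  assumes S: "S \<in> carrier_mat n n" and X: "X \<in> carrier_mat n n" and Y: "Y \<in> carrier_mat n n"
    and inj: "\<And>x. \<lbrakk>x \<in> carrier_vec n; S *\<^sub>v x = 0\<^sub>v n\<rbrakk> \<Longrightarrow> x = 0\<^sub>v n"
    and eq: "\<And>x. x \<in> carrier_vec n \<Longrightarrow> S *\<^sub>v (X *\<^sub>v x) = Y *\<^sub>v (S *\<^sub>v x)"
  shows "similar_mat X Y"
proof -
  have "det S \<noteq> 0"
    using det_0_iff_vec_prod_zero[OF S] inj by blast
  then obtain T where "T \<in> carrier_mat n n" "S * T = 1\<^sub>m n" "T * S = 1\<^sub>m n"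
    using det_non_zero_imp_unit[OF S]
    by (auto simp: Units_def ring_mat_def)
  then have "invertible_mat S"
    using S unfolding invertible_mat_def inverts_mat_def by auto
  moreover have "S * X = Y * S"
    by (rule mat_eq_if_mult_unit_vec_eq[where n = n]) (use S X Y eq in auto)
  ultimately show ?thesis
    using similar_mat_iff_intertwine[OF X Y] S by blast
qed

section \<open>Rank-one matrices up to similarity\<close>

text \<open>
The matrix \<open>u v\<^sup>*\<close>, that is, the operator \<open>x \<mapsto> \<langle>x, v\<rangle> u\<close>.
\<close>

definition outer_prod :: "nat \<Rightarrow> complex vec \<Rightarrow> complex vec \<Rightarrow> complex mat" where
  "outer_prod n u v = mat n n (\<lambda>(i, j). u $ i * cnj (v $ j))"

lemma outer_prod_carrier [simp]: "outer_prod n u v \<in> carrier_mat n n"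
  by (simp add: outer_prod_def)

lemma outer_prod_mult_vec:
  assumes "u \<in> carrier_vec n" "v \<in> carrier_vec n" "x \<in> carrier_vec n"
  shows "outer_prod n u v *\<^sub>v x = (x \<bullet>c v) \<cdot>\<^sub>v u"
  using assms
  by (intro eq_vecI) (auto simp: outer_prod_def scalar_prod_def sum_distrib_left sum_distrib_right
      mult_ac intro!: sum.cong)

lemma mult_outer_prod:
  assumes X: "X \<in> carrier_mat n n" and u: "u \<in> carrier_vec n" and v: "v \<in> carrier_vec n"
  shows "X * outer_prod n u v = outer_prod n (X *\<^sub>v u) v"
  using assms
  by (intro mat_eq_if_mult_unit_vec_eq[where n = n])
     (auto simp: assoc_mult_mat_vec[where n\<^sub>1 = n and n\<^sub>2 = n and n\<^sub>3 = n]
       outer_prod_mult_vec mult_mat_vec[where nr = n and nc = n])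

lemma outer_prod_mult:
  assumes X: "X \<in> carrier_mat n n" and u: "u \<in> carrier_vec n" and v: "v \<in> carrier_vec n"
  shows "outer_prod n u v * X = outer_prod n u (mat_adjoint X *\<^sub>v v)"
proof (rule mat_eq_if_mult_unit_vec_eq[where n = n])
  fix j assume "j < n"
  have "mat_adjoint X *\<^sub>v v \<in> carrier_vec n" "X *\<^sub>v unit_vec n j \<in> carrier_vec n"
    using X v by (auto intro!: mult_mat_vec_carrier[where nr = n and n = n])
  then show "(outer_prod n u v * X) *\<^sub>v unit_vec n j
      = outer_prod n u (mat_adjoint X *\<^sub>v v) *\<^sub>v unit_vec n j"
    using cscalar_prod_adjoint[OF X _ v, of "unit_vec n j"] assms
    by (simp add: assoc_mult_mat_vec[where n\<^sub>1 = n and n\<^sub>2 = n and n\<^sub>3 = n] outer_prod_mult_vec)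
qed (use X in \<open>auto intro!: mult_carrier_mat[where n = n]\<close>)

lemma outer_prod_smult:
  assumes "u \<in> carrier_vec n" "v \<in> carrier_vec n"
  shows "outer_prod n (a \<cdot>\<^sub>v u) v = outer_prod n u (cnj a \<cdot>\<^sub>v v)"
  using assms by (intro eq_matI) (auto simp: outer_prod_def)

text \<open>
The intertwiner is \<open>1 + p q\<^sup>*\<close>. If it kills \<open>x\<close>, then pairing with \<open>q\<close> gives
\<open>\<langle>x, q\<rangle> (1 + \<langle>p, q\<rangle>) = 0\<close>, hence \<open>\<langle>x, q\<rangle> = 0\<close> and \<open>x = 0\<close>.
\<close>

lemma transvection_similar:
  fixes p q :: "complex vec"
  assumes p: "p \<in> carrier_vec n" and q: "q \<in> carrier_vec n" and nz: "1 + p \<bullet>c q \<noteq> 0"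
    and X: "X \<in> carrier_mat n n" and Y: "Y \<in> carrier_mat n n"
    and eq: "\<And>x. x \<in> carrier_vec n \<Longrightarrow>
       X *\<^sub>v x + ((X *\<^sub>v x) \<bullet>c q) \<cdot>\<^sub>v p = Y *\<^sub>v (x + (x \<bullet>c q) \<cdot>\<^sub>v p)"
  shows "similar_mat X Y"
proof -
  define S where "S = 1\<^sub>m n + outer_prod n p q"
  have S: "S \<in> carrier_mat n n" by (simp add: S_def)
  have Sx: "S *\<^sub>v x = x + (x \<bullet>c q) \<cdot>\<^sub>v p" if "x \<in> carrier_vec n" for x
    using that p q unfolding S_def
    by (simp add: add_mult_distrib_mat_vec[where nr = n and nc = n] outer_prod_mult_vec)
  show ?thesis
  proof (rule similar_mat_if_injective_intertwiner[OF S X Y])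
    fix x assume x: "x \<in> carrier_vec n" and "S *\<^sub>v x = 0\<^sub>v n"
    then have 0: "x + (x \<bullet>c q) \<cdot>\<^sub>v p = 0\<^sub>v n" by (simp add: Sx)
    have "(x \<bullet>c q) * (1 + p \<bullet>c q) = (x + (x \<bullet>c q) \<cdot>\<^sub>v p) \<bullet>c q"
      using x p q by (simp add: cscalar_prod_linear[where n = n] distrib_left)
    also have "\<dots> = 0" using q unfolding 0 by simp
    finally have "x \<bullet>c q = 0" using nz by simp
    then show "x = 0\<^sub>v n" using 0 x p by (simp add: zero_smult_vec)
  qed (use X eq Sx in auto)
qed

text \<open>
If neither \<open>u\<close> nor \<open>v\<close> serves up to scaling, they are orthogonal and \<open>u + v\<close> does.
\<close>

lemma common_nonorthogonal_vec:
  fixes u v :: "complex vec"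
  assumes u: "u \<in> carrier_vec n" "u \<noteq> 0\<^sub>v n" and v: "v \<in> carrier_vec n" "v \<noteq> 0\<^sub>v n"
  obtains y where "y \<in> carrier_vec n" "y \<bullet>c u = 1" "y \<bullet>c v \<noteq> 0"
proof -
  have uu: "u \<bullet>c u \<noteq> 0" and vv: "v \<bullet>c v \<noteq> 0"
    using u v by (simp_all add: conjugate_square_eq_0_vec[where n = n])
  have "\<exists>y \<in> carrier_vec n. y \<bullet>c u \<noteq> 0 \<and> y \<bullet>c v \<noteq> 0"
  proof (cases "u \<bullet>c v = 0")
    case True
    moreover have "v \<bullet>c u = 0" using True cscalar_prod_commute[OF u(1) v(1)] by simp
    ultimately show ?thesis using u v uu vv
      by (intro bexI[of _ "u + v"]) (simp_all add: cscalar_prod_linear[where n = n])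
  qed (use u uu in blast)
  then obtain y where "y \<in> carrier_vec n" "y \<bullet>c u \<noteq> 0" "y \<bullet>c v \<noteq> 0" by blast
  then show ?thesis using u v
    by (intro that[of "(1 / (y \<bullet>c u)) \<cdot>\<^sub>v y"]) (simp_all add: cscalar_prod_linear[where n = n])
qed

text \<open>
With \<open>y\<close> normalised by \<open>\<langle>u, y\<rangle> = 1\<close>, the matrix \<open>1 + (u' - u) y\<^sup>*\<close> maps \<open>u\<close> to \<open>u'\<close>; it
preserves \<open>\<langle>\<cdot>, v\<rangle>\<close> because \<open>u' - u\<close> is orthogonal to \<open>v\<close>, and it is invertible because
\<open>\<langle>u', y\<rangle> \<noteq> 0\<close>. The condition on the inner products says that both matrices have the same trace.
\<close>

lemma similar_outer_prod_left:
  assumes u: "u \<in> carrier_vec n" "u \<noteq> 0\<^sub>v n" and u': "u' \<in> carrier_vec n" "u' \<noteq> 0\<^sub>v n"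
    and v: "v \<in> carrier_vec n" and eq: "u \<bullet>c v = u' \<bullet>c v"
  shows "similar_mat (outer_prod n u v) (outer_prod n u' v)"
proof -
  obtain y where y: "y \<in> carrier_vec n" "y \<bullet>c u = 1" "y \<bullet>c u' \<noteq> 0"
    using common_nonorthogonal_vec[OF u u'] by blast
  have y': "u \<bullet>c y = 1" "u' \<bullet>c y \<noteq> 0"
    using y u u' cscalar_prod_commute[of y n] by auto
  show ?thesis
  proof (rule transvection_similar[of "u' - u" n y])
    show "1 + (u' - u) \<bullet>c y \<noteq> 0"
      using y' y u u' by (simp add: cscalar_prod_linear[where n = n])
    fix x :: "complex vec" assume x: "x \<in> carrier_vec n"
    have "x + (x \<bullet>c y) \<cdot>\<^sub>v (u' - u) \<in> carrier_vec n" using x u u' by simp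
    moreover have "(x + (x \<bullet>c y) \<cdot>\<^sub>v (u' - u)) \<bullet>c v = x \<bullet>c v"
      using x y u u' v eq by (simp add: cscalar_prod_linear[where n = n])
    moreover have "(x \<bullet>c v) \<cdot>\<^sub>v u + (((x \<bullet>c v) \<cdot>\<^sub>v u) \<bullet>c y) \<cdot>\<^sub>v (u' - u) = (x \<bullet>c v) \<cdot>\<^sub>v u'"
      unfolding cscalar_prod_smult_left[OF u(1) y(1)] y'(1)
      using u u' by (intro eq_vecI) (auto simp: algebra_simps)
    ultimately show "outer_prod n u v *\<^sub>v x + ((outer_prod n u v *\<^sub>v x) \<bullet>c y) \<cdot>\<^sub>v (u' - u)
        = outer_prod n u' v *\<^sub>v (x + (x \<bullet>c y) \<cdot>\<^sub>v (u' - u))"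
      using x u u' v by (simp add: outer_prod_mult_vec)
  qed (use u u' y in auto)
qed

text \<open>
The counterpart for the second factor, with intertwiner \<open>1 + y (v - v')\<^sup>*\<close>: it fixes \<open>u\<close>, and its
adjoint maps \<open>v'\<close> to \<open>v\<close>.
\<close>

lemma similar_outer_prod_right:
  assumes v: "v \<in> carrier_vec n" "v \<noteq> 0\<^sub>v n" and v': "v' \<in> carrier_vec n" "v' \<noteq> 0\<^sub>v n"
    and u: "u \<in> carrier_vec n" and eq: "u \<bullet>c v = u \<bullet>c v'"
  shows "similar_mat (outer_prod n u v) (outer_prod n u v')"
proof -
  obtain y where y: "y \<in> carrier_vec n" "y \<bullet>c v' = 1" "y \<bullet>c v \<noteq> 0"
    using common_nonorthogonal_vec[OF v' v] by blast
  show ?thesis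
  proof (rule transvection_similar[of y n "v - v'"])
    show "1 + y \<bullet>c (v - v') \<noteq> 0"
      using y v v' by (simp add: cscalar_prod_linear[where n = n])
    fix x :: "complex vec" assume x: "x \<in> carrier_vec n"
    have "x + (x \<bullet>c (v - v')) \<cdot>\<^sub>v y \<in> carrier_vec n" using x y by simp
    moreover have "(x + (x \<bullet>c (v - v')) \<cdot>\<^sub>v y) \<bullet>c v' = x \<bullet>c v"
      using x y v v' by (simp add: cscalar_prod_linear[where n = n])
    moreover have "((x \<bullet>c v) \<cdot>\<^sub>v u) \<bullet>c (v - v') = 0"
      using u v v' eq by (simp add: cscalar_prod_linear[where n = n] del: mult_eq_0_iff)
    ultimately show "outer_prod n u v *\<^sub>v x + ((outer_prod n u v *\<^sub>v x) \<bullet>c (v - v')) \<cdot>\<^sub>v y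
        = outer_prod n u v' *\<^sub>v (x + (x \<bullet>c (v - v')) \<cdot>\<^sub>v y)"
      using x u v v' y by (simp only: outer_prod_mult_vec) (simp add: zero_smult_vec)
  qed (use v v' y in auto)
qed

text \<open>
The reflection along \<open>d = w - p\<close> exchanges two orthogonal vectors of equal norm. Here \<open>r\<close> is the
common squared norm, so that \<open>d\<close> has squared norm \<open>2 r\<close> and the reflection is \<open>1 - d d\<^sup>* / r\<close>.
\<close>

lemma similar_outer_prod_swap:
  assumes p: "p \<in> carrier_vec n" "p \<noteq> 0\<^sub>v n" and w: "w \<in> carrier_vec n"
    and orth: "p \<bullet>c w = 0" and norm: "p \<bullet>c p = w \<bullet>c w"
  shows "similar_mat (outer_prod n p w) (outer_prod n w p)"
proof -
  define r where "r = Re (p \<bullet>c p)"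
  have pp: "p \<bullet>c p = complex_of_real r" and ww: "w \<bullet>c w = complex_of_real r" and r: "r \<noteq> 0"
    using cscalar_prod_self_of_real(1)[OF p(1)] cscalar_prod_self_pos[OF p] norm
    unfolding r_def by auto
  have wp: "w \<bullet>c p = 0" using cscalar_prod_commute[OF p(1) w] orth by simp
  define d where "d = w - p"
  have d: "d \<in> carrier_vec n" using p w by (simp add: d_def)
  define q where "q = complex_of_real (- 1 / r) \<cdot>\<^sub>v d"
  have q: "q \<in> carrier_vec n" using d by (simp add: q_def)
  have xq: "x \<bullet>c q = - (x \<bullet>c d) / r" if "x \<in> carrier_vec n" for x
    using that d unfolding q_def by (simp add: cscalar_prod_linear[where n = n])
  have xd: "x \<bullet>c d = x \<bullet>c w - x \<bullet>c p" if "x \<in> carrier_vec n" for x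
    using that p w unfolding d_def by (simp add: cscalar_prod_linear[where n = n])
  have dp: "d \<bullet>c p = - r" and dw: "d \<bullet>c w = r"
    using p w pp ww wp orth unfolding d_def by (simp_all add: cscalar_prod_linear[where n = n])
  have pq: "p \<bullet>c q = 1" using r pp orth by (simp add: xq xd p)
  show ?thesis
  proof (rule transvection_similar[OF d q])
    show "1 + d \<bullet>c q \<noteq> 0" using r by (simp add: xq xd d dp dw)
    fix x :: "complex vec" assume x: "x \<in> carrier_vec n"
    have "(x + (x \<bullet>c q) \<cdot>\<^sub>v d) \<bullet>c p = x \<bullet>c w"
      using x d p q r by (simp add: cscalar_prod_linear[where n = n] xq xd dp)
    moreover have "(x \<bullet>c w) \<cdot>\<^sub>v p + (((x \<bullet>c w) \<cdot>\<^sub>v p) \<bullet>c q) \<cdot>\<^sub>v d = (x \<bullet>c w) \<cdot>\<^sub>v w"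
      unfolding cscalar_prod_smult_left[OF p(1) q] pq d_def
      using p w by (intro eq_vecI) (auto simp: algebra_simps)
    moreover have "x + (x \<bullet>c q) \<cdot>\<^sub>v d \<in> carrier_vec n" using x d by simp
    ultimately show "outer_prod n p w *\<^sub>v x + ((outer_prod n p w *\<^sub>v x) \<bullet>c q) \<cdot>\<^sub>v d
        = outer_prod n w p *\<^sub>v (x + (x \<bullet>c q) \<cdot>\<^sub>v d)"
      using x p w by (simp only: outer_prod_mult_vec)
  qed simp_all
qed

section \<open>Orthogonal projections\<close>

definition orth_proj :: "nat \<Rightarrow> complex mat \<Rightarrow> bool" where
  "orth_proj n E \<longleftrightarrow> E \<in> carrier_mat n n
     \<and> (\<forall>x \<in> carrier_vec n. \<forall>y \<in> carrier_vec n. (E *\<^sub>v x) \<bullet>c y = x \<bullet>c (E *\<^sub>v y))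
     \<and> (\<forall>x \<in> carrier_vec n. E *\<^sub>v (E *\<^sub>v x) = E *\<^sub>v x)"

lemma orth_projD:
  assumes "orth_proj n E"
  shows "E \<in> carrier_mat n n"
    and "x \<in> carrier_vec n \<Longrightarrow> y \<in> carrier_vec n \<Longrightarrow> (E *\<^sub>v x) \<bullet>c y = x \<bullet>c (E *\<^sub>v y)"
    and "x \<in> carrier_vec n \<Longrightarrow> E *\<^sub>v (E *\<^sub>v x) = E *\<^sub>v x"
    and "x \<in> carrier_vec n \<Longrightarrow> E *\<^sub>v x \<in> carrier_vec n"
  using assms by (auto simp: orth_proj_def)

lemma orth_proj_zero_if_orthogonal:
  assumes E: "orth_proj n E" and x: "x \<in> carrier_vec n" and 0: "x \<bullet>c (E *\<^sub>v x) = 0"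
  shows "E *\<^sub>v x = 0\<^sub>v n"
proof -
  have "(E *\<^sub>v x) \<bullet>c (E *\<^sub>v x) = 0"
    using orth_projD(2)[OF E x orth_projD(4)[OF E x]] orth_projD(3)[OF E x] 0 by simp
  then show ?thesis using orth_projD(4)[OF E x] conjugate_square_eq_0_vec by blast
qed

text \<open>
One Gram-Schmidt step, phrased for the complementary projections: \<open>F'\<close> is \<open>F\<close> minus the projection
onto the line of \<open>g = F v\<close>, so the kernel grows by that line only.
\<close>

lemma orth_proj_shrink:
  assumes F: "orth_proj n F" and v: "v \<in> carrier_vec n"
  obtains F' where "orth_proj n F'" "F' *\<^sub>v v = 0\<^sub>v n"
    "\<And>x. \<lbrakk>x \<in> carrier_vec n; F *\<^sub>v x = 0\<^sub>v n\<rbrakk> \<Longrightarrow> F' *\<^sub>v x = 0\<^sub>v n"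
    "\<And>x. \<lbrakk>x \<in> carrier_vec n; F *\<^sub>v x = x; x \<bullet>c v = 0\<rbrakk> \<Longrightarrow> F' *\<^sub>v x = x"
    "\<And>x. x \<in> carrier_vec n \<Longrightarrow> \<exists>c. F' *\<^sub>v x = F *\<^sub>v x - c \<cdot>\<^sub>v (F *\<^sub>v v)"
proof (cases "F *\<^sub>v v = 0\<^sub>v n")
  case True
  have "\<exists>c. F *\<^sub>v x = F *\<^sub>v x - c \<cdot>\<^sub>v (F *\<^sub>v v)" if "x \<in> carrier_vec n" for x
    unfolding True using orth_projD(4)[OF F that] by (intro exI[of _ 0]) (simp add: zero_smult_vec)
  then show ?thesis using that[of F] True F by blast
next
  case False
  note Fc = orth_projD(4)[OF F]
  define g where "g = F *\<^sub>v v"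
  have g: "g \<in> carrier_vec n" and Fg: "F *\<^sub>v g = g"
    using Fc[OF v] orth_projD(3)[OF F v] by (simp_all add: g_def)
  define r where "r = Re (g \<bullet>c g)"
  have gg: "g \<bullet>c g = complex_of_real r" and r: "r \<noteq> 0"
    using cscalar_prod_self_of_real(1)[OF g] cscalar_prod_self_pos[OF g] False
    unfolding r_def g_def by auto
  have xg: "(F *\<^sub>v x) \<bullet>c g = x \<bullet>c g" "x \<bullet>c g = (F *\<^sub>v x) \<bullet>c v" if "x \<in> carrier_vec n" for x
    using orth_projD(2)[OF F that g] orth_projD(2)[OF F that v] Fg by (simp_all add: g_def)
  define F' where "F' = F - outer_prod n (complex_of_real (1 / r) \<cdot>\<^sub>v g) g"
  have F': "F' \<in> carrier_mat n n" using orth_projD(1)[OF F] unfolding F'_def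
    by (intro minus_carrier_mat outer_prod_carrier)
  have F'x: "F' *\<^sub>v x = F *\<^sub>v x - (x \<bullet>c g / r) \<cdot>\<^sub>v g" if x: "x \<in> carrier_vec n" for x
  proof -
    have "F' *\<^sub>v x = F *\<^sub>v x - outer_prod n (complex_of_real (1 / r) \<cdot>\<^sub>v g) g *\<^sub>v x"
      unfolding F'_def using orth_projD(1)[OF F] x
      by (intro minus_mult_distrib_mat_vec[where nr = n and nc = n]) auto
    then show ?thesis using x g by (simp add: outer_prod_mult_vec smult_smult_assoc)
  qed
  have F'g: "(F' *\<^sub>v x) \<bullet>c g = 0" if "x \<in> carrier_vec n" for x
    using that g Fc[OF that] r
    by (simp add: F'x xg(1) gg cscalar_prod_linear[where n = n])
  have "orth_proj n F'"
    unfolding orth_proj_def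
  proof (intro conjI ballI F')
    fix x y :: "complex vec" assume x: "x \<in> carrier_vec n" and y: "y \<in> carrier_vec n"
    show "(F' *\<^sub>v x) \<bullet>c y = x \<bullet>c (F' *\<^sub>v y)"
      using x y g Fc[OF x] Fc[OF y] orth_projD(2)[OF F x y] cscalar_prod_commute[OF y g]
      by (simp add: F'x cscalar_prod_linear[where n = n])
  next
    fix x :: "complex vec" assume x: "x \<in> carrier_vec n"
    have F'xc: "F' *\<^sub>v x \<in> carrier_vec n" using F' x by simp
    have "F *\<^sub>v (F' *\<^sub>v x) = F *\<^sub>v (F *\<^sub>v x) - F *\<^sub>v ((x \<bullet>c g / r) \<cdot>\<^sub>v g)"
      unfolding F'x[OF x] using orth_projD(1)[OF F] Fc[OF x] g
      by (intro mult_minus_distrib_mat_vec[where nr = n and nc = n]) auto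
    also have "\<dots> = F' *\<^sub>v x"
      using orth_projD(1,3)[OF F] x g Fg
      by (simp add: F'x mult_mat_vec[where nr = n and nc = n])
    finally have "F *\<^sub>v (F' *\<^sub>v x) = F' *\<^sub>v x" .
    then show "F' *\<^sub>v (F' *\<^sub>v x) = F' *\<^sub>v x"
      using F'x[OF F'xc] F'g[OF x] F'xc g by (simp add: zero_smult_vec)
  qed
  moreover have "F' *\<^sub>v v = 0\<^sub>v n"
  proof -
    have "v \<bullet>c g / r = 1" using xg(1)[OF v] gg r by (simp add: g_def)
    then show ?thesis using g unfolding F'x[OF v] g_def[symmetric] by simp
  qed
  moreover have "F' *\<^sub>v x = 0\<^sub>v n" if "x \<in> carrier_vec n" "F *\<^sub>v x = 0\<^sub>v n" for x
    using that g v by (simp add: F'x xg(2) zero_smult_vec)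
  moreover have "F' *\<^sub>v x = x" if "x \<in> carrier_vec n" "F *\<^sub>v x = x" "x \<bullet>c v = 0" for x
    using that g by (simp add: F'x xg(2) zero_smult_vec)
  ultimately show ?thesis
    using that[of F'] F'x unfolding g_def by blast
qed

lemma orth_proj_one: "orth_proj n (1\<^sub>m n)"
  by (simp add: orth_proj_def)

lemma orth_proj_onto_complement:
  assumes "set vs \<subseteq> carrier_vec n"
  shows "\<exists>F. orth_proj n F \<and> (\<forall>v \<in> set vs. F *\<^sub>v v = 0\<^sub>v n)
     \<and> (\<forall>x \<in> carrier_vec n. (\<forall>v \<in> set vs. x \<bullet>c v = 0) \<longrightarrow> F *\<^sub>v x = x)"
  using assms
proof (induction vs)
  case Nil
  then show ?case using orth_proj_one by (intro exI[of _ "1\<^sub>m n"]) simp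
next
  case (Cons v vs)
  then obtain F where F: "orth_proj n F" "\<forall>v \<in> set vs. F *\<^sub>v v = 0\<^sub>v n"
    "\<forall>x \<in> carrier_vec n. (\<forall>v \<in> set vs. x \<bullet>c v = 0) \<longrightarrow> F *\<^sub>v x = x" by auto
  have v: "v \<in> carrier_vec n" and vs: "\<And>u. u \<in> set vs \<Longrightarrow> u \<in> carrier_vec n"
    using Cons.prems by auto
  show ?case
    by (rule orth_proj_shrink[OF F(1) v], rule exI, intro conjI, assumption)
       (use F(2,3) vs in auto)
qed

text \<open>
Two Gram-Schmidt steps; unwinding them expresses a vector of the kernel in \<open>s1\<close> and \<open>s2\<close>.
\<close>

lemma orth_proj_onto_complement_pair:
  assumes s1: "s1 \<in> carrier_vec n" and s2: "s2 \<in> carrier_vec n"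
  obtains E where "orth_proj n E" "E *\<^sub>v s1 = 0\<^sub>v n" "E *\<^sub>v s2 = 0\<^sub>v n"
    "\<And>x. \<lbrakk>x \<in> carrier_vec n; E *\<^sub>v x = 0\<^sub>v n\<rbrakk> \<Longrightarrow> \<exists>a b. x = a \<cdot>\<^sub>v s1 + b \<cdot>\<^sub>v s2"
proof -
  obtain F where F: "orth_proj n F" "F *\<^sub>v s1 = 0\<^sub>v n"
    "\<And>x. x \<in> carrier_vec n \<Longrightarrow> \<exists>c. F *\<^sub>v x = 1\<^sub>m n *\<^sub>v x - c \<cdot>\<^sub>v (1\<^sub>m n *\<^sub>v s1)"
    by (rule orth_proj_shrink[OF orth_proj_one s1]) blast
  obtain E where E: "orth_proj n E" "E *\<^sub>v s2 = 0\<^sub>v n"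
    "\<And>x. \<lbrakk>x \<in> carrier_vec n; F *\<^sub>v x = 0\<^sub>v n\<rbrakk> \<Longrightarrow> E *\<^sub>v x = 0\<^sub>v n"
    "\<And>x. x \<in> carrier_vec n \<Longrightarrow> \<exists>c. E *\<^sub>v x = F *\<^sub>v x - c \<cdot>\<^sub>v (F *\<^sub>v s2)"
    by (rule orth_proj_shrink[OF F(1) s2]) blast
  have "\<exists>a b. x = a \<cdot>\<^sub>v s1 + b \<cdot>\<^sub>v s2" if x: "x \<in> carrier_vec n" and Ex: "E *\<^sub>v x = 0\<^sub>v n" for x
  proof -
    obtain c d e where cde: "F *\<^sub>v x = x - c \<cdot>\<^sub>v s1" "F *\<^sub>v s2 = s2 - d \<cdot>\<^sub>v s1"
      "0\<^sub>v n = (x - c \<cdot>\<^sub>v s1) - e \<cdot>\<^sub>v (s2 - d \<cdot>\<^sub>v s1)"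
      using F(3)[OF x] F(3)[OF s2] E(4)[OF x] x s1 s2 Ex by auto
    have "x = (c - e * d) \<cdot>\<^sub>v s1 + e \<cdot>\<^sub>v s2"
    proof (rule eq_vecI)
      fix i assume "i < dim_vec ((c - e * d) \<cdot>\<^sub>v s1 + e \<cdot>\<^sub>v s2)"
      then have i: "i < n" using s2 by simp
      show "x $ i = ((c - e * d) \<cdot>\<^sub>v s1 + e \<cdot>\<^sub>v s2) $ i"
        using arg_cong[OF cde(3), of "\<lambda>v. v $ i"] i x s1 s2 by (simp add: algebra_simps)
    qed (use x s2 in auto)
    then show ?thesis by blast
  qed
  then show ?thesis using that[of E] E F s1 by blast
qed

text \<open>
\<open>E A = 0\<close> gives \<open>A\<^sup>* E = 0\<close> by taking adjoints, and \<open>A\<close> has the same kernel as \<open>A\<^sup>*\<close>.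
\<close>

lemma orth_proj_normal_annihilates:
  assumes E: "orth_proj n E" and A: "A \<in> carrier_mat n n" and nA: "normal_mat A"
    and EA: "\<And>x. x \<in> carrier_vec n \<Longrightarrow> E *\<^sub>v (A *\<^sub>v x) = 0\<^sub>v n"
    and x: "x \<in> carrier_vec n"
  shows "A *\<^sub>v (E *\<^sub>v x) = 0\<^sub>v n"
proof -
  have Ex: "E *\<^sub>v x \<in> carrier_vec n" using orth_projD(4)[OF E x] .
  have "mat_adjoint A *\<^sub>v (E *\<^sub>v x) = 0\<^sub>v n"
  proof (rule zero_if_orthogonal_to_all)
    fix y :: "complex vec" assume y: "y \<in> carrier_vec n"
    have Ay: "A *\<^sub>v y \<in> carrier_vec n" using A y by simp
    have "y \<bullet>c (mat_adjoint A *\<^sub>v (E *\<^sub>v x)) = (E *\<^sub>v (A *\<^sub>v y)) \<bullet>c x"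
      using cscalar_prod_adjoint[OF A y Ex] orth_projD(2)[OF E Ay x] by simp
    then show "y \<bullet>c (mat_adjoint A *\<^sub>v (E *\<^sub>v x)) = 0" using EA[OF y] x by simp
  qed (use A Ex in \<open>auto intro!: mult_mat_vec_carrier[where nr = n and n = n]\<close>)
  then show ?thesis using normal_mat_kernel[OF A nA Ex] by blast
qed

text \<open>
Projecting onto the orthogonal complement of the range of \<open>B\<close> is enough, since for normal \<open>B\<close> this
complement is the kernel.
\<close>

lemma orth_proj_onto_kernel:
  assumes B: "B \<in> carrier_mat n n" and nB: "normal_mat B"
  obtains F where "orth_proj n F"
    "\<And>x. x \<in> carrier_vec n \<Longrightarrow> F *\<^sub>v (B *\<^sub>v x) = 0\<^sub>v n"
    "\<And>x. x \<in> carrier_vec n \<Longrightarrow> B *\<^sub>v (F *\<^sub>v x) = 0\<^sub>v n"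
    "\<And>x. \<lbrakk>x \<in> carrier_vec n; B *\<^sub>v x = 0\<^sub>v n\<rbrakk> \<Longrightarrow> F *\<^sub>v x = x"
proof -
  let ?vs = "map (\<lambda>j. B *\<^sub>v unit_vec n j) [0..<n]"
  have "set ?vs \<subseteq> carrier_vec n" using B by auto
  then obtain F where F: "orth_proj n F"
    and F0: "\<And>j. j < n \<Longrightarrow> F *\<^sub>v (B *\<^sub>v unit_vec n j) = 0\<^sub>v n"
    and F1: "\<And>x. \<lbrakk>x \<in> carrier_vec n; \<And>j. j < n \<Longrightarrow> x \<bullet>c (B *\<^sub>v unit_vec n j) = 0\<rbrakk> \<Longrightarrow> F *\<^sub>v x = x"
    using orth_proj_onto_complement[of ?vs n] by auto
  note Fc = orth_projD(1)[OF F]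
  have "F * B = 0\<^sub>m n n"
    by (rule mat_eq_if_mult_unit_vec_eq[where n = n])
       (use Fc B F0 in \<open>auto simp: assoc_mult_mat_vec[where n\<^sub>1 = n and n\<^sub>2 = n and n\<^sub>3 = n]\<close>)
  then have FB: "F *\<^sub>v (B *\<^sub>v x) = 0\<^sub>v n" if "x \<in> carrier_vec n" for x
    using assoc_mult_mat_vec[OF Fc B that, symmetric] that by (auto intro!: eq_vecI)
  have "F *\<^sub>v x = x" if x: "x \<in> carrier_vec n" and Bx: "B *\<^sub>v x = 0\<^sub>v n" for x
  proof (rule F1[OF x])
    fix j assume "j < n"
    then show "x \<bullet>c (B *\<^sub>v unit_vec n j) = 0"
      using cscalar_prod_adjoint[of "mat_adjoint B" n x "unit_vec n j"]
        normal_mat_kernel[OF B nB x] Bx B x by simp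
  qed
  then show ?thesis
    using that[of F] F FB orth_proj_normal_annihilates[OF F B nB FB] by blast
qed

section \<open>When only zero is common to the range of one factor and the kernel of the other\<close>

text \<open>
The intertwiner is \<open>S = B + E F E\<close>, where \<open>F\<close> projects orthogonally onto the kernel of \<open>B\<close>. Since
\<open>E\<close> annihilates \<open>A\<close> on both sides, the second summand does not affect
\<open>S (A B) = B A B = (B A) S\<close>; it is there to make \<open>S\<close> invertible.

For injectivity let \<open>S x = 0\<close> and \<open>u = F E x\<close>. Applying \<open>F\<close> removes \<open>B x\<close> and leaves
\<open>F E u = 0\<close>, so \<open>\<langle>u, E u\<rangle> = \<langle>E x, F E u\<rangle> = 0\<close>. Hence \<open>u\<close> lies in the kernels of both \<open>E\<close> and \<open>B\<close>
and vanishes. Then \<open>B x = 0\<close>, so \<open>F x = x\<close> and \<open>\<langle>x, E x\<rangle> = \<langle>x, u\<rangle> = 0\<close>, and \<open>x\<close> vanishes for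
the same reason.
\<close>

lemma similar_products_if_range_meets_kernel_trivially:
  assumes A: "A \<in> carrier_mat n n" and B: "B \<in> carrier_mat n n" and nB: "normal_mat B"
    and E: "orth_proj n E"
    and EA: "\<And>x. x \<in> carrier_vec n \<Longrightarrow> E *\<^sub>v (A *\<^sub>v x) = 0\<^sub>v n"
    and AE: "\<And>x. x \<in> carrier_vec n \<Longrightarrow> A *\<^sub>v (E *\<^sub>v x) = 0\<^sub>v n"
    and triv: "\<And>x. \<lbrakk>x \<in> carrier_vec n; E *\<^sub>v x = 0\<^sub>v n; B *\<^sub>v x = 0\<^sub>v n\<rbrakk> \<Longrightarrow> x = 0\<^sub>v n"
  shows "similar_mat (A * B) (B * A)"
proof -
  obtain F where F: "orth_proj n F"
    and FB: "\<And>x. x \<in> carrier_vec n \<Longrightarrow> F *\<^sub>v (B *\<^sub>v x) = 0\<^sub>v n"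
    and BF: "\<And>x. x \<in> carrier_vec n \<Longrightarrow> B *\<^sub>v (F *\<^sub>v x) = 0\<^sub>v n"
    and Fk: "\<And>x. \<lbrakk>x \<in> carrier_vec n; B *\<^sub>v x = 0\<^sub>v n\<rbrakk> \<Longrightarrow> F *\<^sub>v x = x"
    using orth_proj_onto_kernel[OF B nB] by blast
  note Ec = orth_projD(4)[OF E] and Fc = orth_projD(4)[OF F]
  note Em = orth_projD(1)[OF E] and Fm = orth_projD(1)[OF F]
  have Ac: "A *\<^sub>v x \<in> carrier_vec n" and Bc: "B *\<^sub>v x \<in> carrier_vec n"
    if "x \<in> carrier_vec n" for x using A B that by auto
  have E0: "E *\<^sub>v 0\<^sub>v n = 0\<^sub>v n" and F0: "F *\<^sub>v 0\<^sub>v n = 0\<^sub>v n" using Em Fm by auto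
  define S where "S = B + E * (F * E)"
  have S: "S \<in> carrier_mat n n" using B Em Fm by (simp add: S_def)
  have Sx: "S *\<^sub>v x = B *\<^sub>v x + E *\<^sub>v (F *\<^sub>v (E *\<^sub>v x))" if x: "x \<in> carrier_vec n" for x
  proof -
    have "S *\<^sub>v x = B *\<^sub>v x + (E * (F * E)) *\<^sub>v x"
      unfolding S_def using B Em Fm x
      by (intro add_mult_distrib_mat_vec[where nr = n and nc = n]) auto
    also have "(E * (F * E)) *\<^sub>v x = E *\<^sub>v (F *\<^sub>v (E *\<^sub>v x))"
      using Em Fm x by (simp add: assoc_mult_mat_vec[where n\<^sub>1 = n and n\<^sub>2 = n and n\<^sub>3 = n])
    finally show ?thesis .
  qed
  show ?thesis
  proof (rule similar_mat_if_injective_intertwiner[OF S])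
    fix x :: "complex vec" assume x: "x \<in> carrier_vec n" and S0: "S *\<^sub>v x = 0\<^sub>v n"
    define u where "u = F *\<^sub>v (E *\<^sub>v x)"
    have u: "u \<in> carrier_vec n" using x Ec Fc by (simp add: u_def)
    have sum0: "B *\<^sub>v x + E *\<^sub>v u = 0\<^sub>v n" using S0 Sx[OF x] by (simp add: u_def)
    have "F *\<^sub>v (B *\<^sub>v x + E *\<^sub>v u) = F *\<^sub>v (B *\<^sub>v x) + F *\<^sub>v (E *\<^sub>v u)"
      using Fm Bc[OF x] Ec[OF u] by (rule mult_add_distrib_mat_vec)
    then have "0\<^sub>v n = 0\<^sub>v n + F *\<^sub>v (E *\<^sub>v u)" unfolding sum0 F0 FB[OF x] .
    then have FEu: "F *\<^sub>v (E *\<^sub>v u) = 0\<^sub>v n"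
      using left_zero_vec[OF Fc[OF Ec[OF u]]] by metis
    have "u \<bullet>c (E *\<^sub>v u) = (E *\<^sub>v x) \<bullet>c (F *\<^sub>v (E *\<^sub>v u))"
      unfolding u_def using x Ec Fc orth_projD(2)[OF F] by simp
    then have "u \<bullet>c (E *\<^sub>v u) = 0" using Ec[OF x] unfolding FEu by simp
    then have "E *\<^sub>v u = 0\<^sub>v n" by (rule orth_proj_zero_if_orthogonal[OF E u])
    moreover have "B *\<^sub>v u = 0\<^sub>v n" using BF[OF Ec[OF x]] by (simp add: u_def)
    ultimately have u0: "u = 0\<^sub>v n" using triv[OF u] by blast
    then have Bx: "B *\<^sub>v x = 0\<^sub>v n" using sum0 right_zero_vec[OF Bc[OF x]] unfolding u0 E0 by metis
    have "x \<bullet>c (E *\<^sub>v x) = x \<bullet>c u"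
      using orth_projD(2)[OF F x Ec[OF x]] Fk[OF x Bx] by (simp add: u_def)
    then have "x \<bullet>c (E *\<^sub>v x) = 0" using x unfolding u0 by simp
    then have "E *\<^sub>v x = 0\<^sub>v n" by (rule orth_proj_zero_if_orthogonal[OF E x])
    then show "x = 0\<^sub>v n" using triv[OF x] Bx by blast
  next
    fix x :: "complex vec" assume x: "x \<in> carrier_vec n"
    have "(A * B) *\<^sub>v x = A *\<^sub>v (B *\<^sub>v x)" using A B x by simp
    moreover have "S *\<^sub>v (A *\<^sub>v (B *\<^sub>v x)) = B *\<^sub>v (A *\<^sub>v (B *\<^sub>v x))"
      using Sx[OF Ac[OF Bc[OF x]]] EA[OF Bc[OF x]] E0 F0 Bc[OF Ac[OF Bc[OF x]]] by simp
    moreover have "(B * A) *\<^sub>v (S *\<^sub>v x) = B *\<^sub>v (A *\<^sub>v (B *\<^sub>v x))"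
    proof -
      let ?v = "E *\<^sub>v (F *\<^sub>v (E *\<^sub>v x))"
      have v: "?v \<in> carrier_vec n" using x Ec Fc by simp
      have "A *\<^sub>v (S *\<^sub>v x) = A *\<^sub>v (B *\<^sub>v x) + A *\<^sub>v ?v"
        unfolding Sx[OF x] using A Bc[OF x] v by (rule mult_add_distrib_mat_vec)
      then have "A *\<^sub>v (S *\<^sub>v x) = A *\<^sub>v (B *\<^sub>v x)"
        using AE[OF Fc[OF Ec[OF x]]] Ac[OF Bc[OF x]] by simp
      then show ?thesis using A B S x by simp
    qed
    ultimately show "S *\<^sub>v ((A * B) *\<^sub>v x) = (B * A) *\<^sub>v (S *\<^sub>v x)" by simp
  qed (use A B in auto)
qed

section \<open>Matrices of rank at most two\<close>

text \<open>
A maximal linearly independent set of columns has at most two elements and spans the column space;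
missing elements are replaced by zero vectors.
\<close>

lemma rank_le_2_range:
  fixes A :: "complex mat"
  assumes A: "A \<in> carrier_mat n n" and rk: "vec_space.rank n A \<le> 2"
  obtains s1 s2 where "s1 \<in> carrier_vec n" "s2 \<in> carrier_vec n"
    "\<And>x. x \<in> carrier_vec n \<Longrightarrow> \<exists>a b. A *\<^sub>v x = a \<cdot>\<^sub>v s1 + b \<cdot>\<^sub>v s2"
proof -
  interpret vec_space "TYPE(complex)" n .
  let ?C = "set (cols A)"
  have C: "?C \<subseteq> carrier_vec n" using A cols_dim by blast
  obtain U where U: "finite U" "maximal U (\<lambda>T. T \<subseteq> ?C \<and> lin_indpt T)"
    using maximal_exists_superset[of ?C "\<lambda>T. T \<subseteq> ?C \<and> lin_indpt T" "{}"]
    by (auto simp: lin_dep_def)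
  have cardU: "card U \<le> 2" using rank_card_indpt[OF A U(2)] rk by simp
  have UC: "U \<subseteq> ?C" "lin_indpt U" using U(2) unfolding maximal_def by auto
  then have Uc: "U \<subseteq> carrier_vec n" using C by blast
  have "?C \<subseteq> span U"
  proof
    fix c assume c: "c \<in> ?C"
    show "c \<in> span U"
    proof (rule ccontr)
      assume not: "c \<notin> span U"
      then have "c \<notin> U" using Uc span_mem by blast
      moreover from this have "lin_indpt (U \<union> {c})"
        using lin_dep_iff_in_span[of U c] Uc UC(2) c C not by auto
      ultimately show False using U(2) UC(1) c unfolding maximal_def by blast
    qed
  qed
  then have span: "span ?C \<subseteq> span U" using span_subsetI[OF Uc] by blast
  obtain us where us: "set us = U" "distinct us" using finite_distinct_list[OF U(1)] by blast
  have len: "length us \<le> 2" using cardU us distinct_card[of us] by simp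
  define g where "g i = (if i < length us then us ! i else 0\<^sub>v n)" for i
  have g: "g i \<in> carrier_vec n" for i
    using us Uc unfolding g_def by (metis nth_mem subsetD zero_carrier_vec)
  have "\<exists>a b. A *\<^sub>v x = a \<cdot>\<^sub>v g 0 + b \<cdot>\<^sub>v g 1" if x: "x \<in> carrier_vec n" for x
  proof -
    have "A *\<^sub>v x \<in> span ?C"
      using col_space_eq[OF A] A x by (auto simp: col_space_def)
    then have "A *\<^sub>v x \<in> span_list us"
      using span us Uc span_list_as_span[of us] by auto
    then obtain c where c: "A *\<^sub>v x = lincomb_list c us" unfolding span_list_def by blast
    consider "us = []" | s where "us = [s]" | s t where "us = [s, t]"
      using len by (cases us rule: list.exhaust; cases "tl us" rule: list.exhaust) auto
    then have "lincomb_list c us = c 0 \<cdot>\<^sub>v g 0 + c 1 \<cdot>\<^sub>v g 1"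
      using us Uc by cases (auto simp: lincomb_list_def g_def)
    then show ?thesis using c by auto
  qed
  then show ?thesis using that[of "g 0" "g 1"] g by blast
qed

text \<open>
The projection onto the complement of \<open>m\<close> has the line of \<open>m\<close> as its kernel, which meets the kernel
of \<open>B\<close> only in zero because \<open>B m \<noteq> 0\<close>.
\<close>

lemma similar_products_outer_prod:
  assumes B: "B \<in> carrier_mat n n" and nB: "normal_mat B"
    and m: "m \<in> carrier_vec n" and Bm: "B *\<^sub>v m \<noteq> 0\<^sub>v n"
  shows "similar_mat (outer_prod n (a \<cdot>\<^sub>v m) m * B) (B * outer_prod n (a \<cdot>\<^sub>v m) m)"
proof -
  obtain E where E: "orth_proj n E" and Em: "E *\<^sub>v m = 0\<^sub>v n"
    and Ex: "\<And>x. x \<in> carrier_vec n \<Longrightarrow> \<exists>c. E *\<^sub>v x = 1\<^sub>m n *\<^sub>v x - c \<cdot>\<^sub>v (1\<^sub>m n *\<^sub>v m)"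
    by (rule orth_proj_shrink[OF orth_proj_one m]) blast
  note EC = orth_projD(1)[OF E]
  show ?thesis
  proof (rule similar_products_if_range_meets_kernel_trivially[OF _ B nB E])
    fix x :: "complex vec" assume x: "x \<in> carrier_vec n"
    show "E *\<^sub>v (outer_prod n (a \<cdot>\<^sub>v m) m *\<^sub>v x) = 0\<^sub>v n"
      using EC m x Em by (simp add: smult_zero_vec outer_prod_mult_vec mult_mat_vec[where nr = n and nc = n])
    have "(E *\<^sub>v x) \<bullet>c m = 0" using orth_projD(2)[OF E x m] Em x by simp
    then show "outer_prod n (a \<cdot>\<^sub>v m) m *\<^sub>v (E *\<^sub>v x) = 0\<^sub>v n"
      using orth_projD(4)[OF E x] m by (simp add: outer_prod_mult_vec zero_smult_vec)
  next
    fix x :: "complex vec"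
    assume x: "x \<in> carrier_vec n" and "E *\<^sub>v x = 0\<^sub>v n" and Bx: "B *\<^sub>v x = 0\<^sub>v n"
    then obtain c where c: "0\<^sub>v n = x - c \<cdot>\<^sub>v m" using Ex[OF x] x m by auto
    have xc: "x = c \<cdot>\<^sub>v m"
      by (rule eq_if_diff_zero_vec[OF x _ c[symmetric]]) (use m in simp)
    have "B *\<^sub>v x = c \<cdot>\<^sub>v (B *\<^sub>v m)" unfolding xc by (rule mult_mat_vec[OF B m])
    then have "c = 0" using smult_eq_zero_vec[OF _ Bm] Bx by simp
    then show "x = 0\<^sub>v n" using xc m by (simp add: zero_smult_vec)
  qed simp
qed

text \<open>
The Steinitz exchange for two vectors: \<open>l\<close> replaces one that occurs in it with a nonzero coefficient.
\<close>

lemma pair_span_exchange: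
  fixes l s1 s2 :: "complex vec"
  assumes s: "s1 \<in> carrier_vec n" "s2 \<in> carrier_vec n" and l: "l \<in> carrier_vec n" "l \<noteq> 0\<^sub>v n"
    and lab: "l = a \<cdot>\<^sub>v s1 + b \<cdot>\<^sub>v s2"
  obtains s where "s \<in> carrier_vec n" "\<And>p q. \<exists>p' q'. p \<cdot>\<^sub>v s1 + q \<cdot>\<^sub>v s2 = p' \<cdot>\<^sub>v l + q' \<cdot>\<^sub>v s"
proof (cases "a = 0")
  case True
  then have b: "b \<noteq> 0" using l lab s by (auto simp: zero_smult_vec)
  have "p \<cdot>\<^sub>v s1 + q \<cdot>\<^sub>v s2 = (q / b) \<cdot>\<^sub>v l + p \<cdot>\<^sub>v s1" for p q
    unfolding lab True using s b by (intro eq_vecI) auto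
  then show ?thesis using that[of s1] s by blast
next
  case a: False
  have "p \<cdot>\<^sub>v s1 + q \<cdot>\<^sub>v s2 = (p / a) \<cdot>\<^sub>v l + (q - p * b / a) \<cdot>\<^sub>v s2" for p q
    unfolding lab using s a by (intro eq_vecI) (auto simp: field_simps)
  then show ?thesis using that[of s2] s by blast
qed

text \<open>
Gram-Schmidt applied to \<open>l\<close> and \<open>s\<close>. The vector \<open>m\<close> is zero when \<open>s\<close> is a multiple of \<open>l\<close>, which
allows for matrices of rank one.
\<close>

lemma orthonormal_pair_containing:
  fixes l s :: "complex vec"
  assumes l: "l \<in> carrier_vec n" "l \<bullet>c l = 1" and s: "s \<in> carrier_vec n"
  obtains m where "m \<in> carrier_vec n" "l \<bullet>c m = 0" "m = 0\<^sub>v n \<or> m \<bullet>c m = 1"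
    "\<And>p q. \<exists>p' q'. p \<cdot>\<^sub>v l + q \<cdot>\<^sub>v s = p' \<cdot>\<^sub>v l + q' \<cdot>\<^sub>v m"
proof -
  define d where "d = s - (s \<bullet>c l) \<cdot>\<^sub>v l"
  have d: "d \<in> carrier_vec n" using l s by (simp add: d_def)
  have ld: "l \<bullet>c d = 0"
    using l s cscalar_prod_commute[OF s l(1)] unfolding d_def
    by (simp add: cscalar_prod_linear[where n = n])
  have sd: "p \<cdot>\<^sub>v l + q \<cdot>\<^sub>v s = (p + q * (s \<bullet>c l)) \<cdot>\<^sub>v l + q \<cdot>\<^sub>v d" for p q
    unfolding d_def using l s by (intro eq_vecI) (auto simp: algebra_simps)
  show ?thesis
  proof (cases "d = 0\<^sub>v n")
    case True
    then show ?thesis using that[of d] d ld sd by blast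
  next
    case False
    obtain t where t: "t \<noteq> 0" "(t \<cdot>\<^sub>v d) \<bullet>c (t \<cdot>\<^sub>v d) = complex_of_real 1"
      using scale_to_norm[OF d False, of 1] by auto
    have "p \<cdot>\<^sub>v l + q \<cdot>\<^sub>v s = (p + q * (s \<bullet>c l)) \<cdot>\<^sub>v l + (q / t) \<cdot>\<^sub>v (t \<cdot>\<^sub>v d)" for p q
      unfolding sd using t by (simp add: smult_smult_assoc)
    moreover have "l \<bullet>c (t \<cdot>\<^sub>v d) = 0" using ld cscalar_prod_smult_right[OF l(1) d] by simp
    ultimately show ?thesis using that[of "t \<cdot>\<^sub>v d"] d t(2) by auto
  qed
qed

text \<open>
Let \<open>y\<close> be the orthogonal projection of \<open>x\<close> onto the span of \<open>l\<close> and \<open>m\<close>. Then \<open>x - y\<close> is orthogonal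
to the range of \<open>A\<close>, so \<open>A\<^sup>*\<close> kills it, and by normality so does \<open>A\<close>.
\<close>

lemma normal_mat_eq_on_orthonormal_pair:
  assumes A: "A \<in> carrier_mat n n" and nA: "normal_mat A"
    and l: "l \<in> carrier_vec n" "l \<bullet>c l = 1" and m: "m \<in> carrier_vec n" "m = 0\<^sub>v n \<or> m \<bullet>c m = 1"
    and lm: "l \<bullet>c m = 0"
    and range: "\<And>x. x \<in> carrier_vec n \<Longrightarrow> \<exists>p q. A *\<^sub>v x = p \<cdot>\<^sub>v l + q \<cdot>\<^sub>v m"
    and x: "x \<in> carrier_vec n"
  shows "A *\<^sub>v x = (x \<bullet>c l) \<cdot>\<^sub>v (A *\<^sub>v l) + (x \<bullet>c m) \<cdot>\<^sub>v (A *\<^sub>v m)"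
    and "A *\<^sub>v x = ((A *\<^sub>v x) \<bullet>c l) \<cdot>\<^sub>v l + ((A *\<^sub>v x) \<bullet>c m) \<cdot>\<^sub>v m"
proof -
  have ml: "m \<bullet>c l = 0" using lm cscalar_prod_commute[OF l(1) m(1)] by simp
  define y where "y = (x \<bullet>c l) \<cdot>\<^sub>v l + (x \<bullet>c m) \<cdot>\<^sub>v m"
  have y: "y \<in> carrier_vec n" using l m by (simp add: y_def)
  have xy: "x - y \<in> carrier_vec n" using x y by simp
  have orth: "(x - y) \<bullet>c l = 0" "(x - y) \<bullet>c m = 0"
    using x y l m(1) lm ml m(2) unfolding y_def
    by (auto simp: cscalar_prod_linear[where n = n])
  have "mat_adjoint A *\<^sub>v (x - y) = 0\<^sub>v n"
  proof (rule zero_if_orthogonal_to_all)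
    fix z :: "complex vec" assume z: "z \<in> carrier_vec n"
    obtain p q where pq: "A *\<^sub>v z = p \<cdot>\<^sub>v l + q \<cdot>\<^sub>v m" using range[OF z] by blast
    have "(A *\<^sub>v z) \<bullet>c (x - y) = p * (l \<bullet>c (x - y)) + q * (m \<bullet>c (x - y))"
      unfolding pq using xy l m by (simp add: cscalar_prod_smult_left[where n = n] cscalar_prod_add_left[where n = n])
    also have "\<dots> = 0"
      using orth cscalar_prod_commute[OF xy l(1)] cscalar_prod_commute[OF xy m(1)] by simp
    finally show "z \<bullet>c (mat_adjoint A *\<^sub>v (x - y)) = 0" using cscalar_prod_adjoint[OF A z xy] by simp
  qed (use A xy in \<open>auto intro!: mult_mat_vec_carrier[where nr = n and n = n]\<close>)
  then have "A *\<^sub>v (x - y) = 0\<^sub>v n" using normal_mat_kernel[OF A nA xy] by blast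
  then have "A *\<^sub>v x - A *\<^sub>v y = 0\<^sub>v n" using mult_minus_distrib_mat_vec[OF A x y] by simp
  then have "A *\<^sub>v x = A *\<^sub>v y"
    by (rule eq_if_diff_zero_vec[OF mult_mat_vec_carrier[OF A x] mult_mat_vec_carrier[OF A y]])
  also have "A *\<^sub>v y = A *\<^sub>v ((x \<bullet>c l) \<cdot>\<^sub>v l) + A *\<^sub>v ((x \<bullet>c m) \<cdot>\<^sub>v m)"
    unfolding y_def using A l m by (intro mult_add_distrib_mat_vec[where nr = n and nc = n]) auto
  finally show "A *\<^sub>v x = (x \<bullet>c l) \<cdot>\<^sub>v (A *\<^sub>v l) + (x \<bullet>c m) \<cdot>\<^sub>v (A *\<^sub>v m)"
    using A l m by (simp add: mult_mat_vec[where nr = n and nc = n])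
  obtain p q where pq: "A *\<^sub>v x = p \<cdot>\<^sub>v l + q \<cdot>\<^sub>v m" using range[OF x] by blast
  have "(A *\<^sub>v x) \<bullet>c l = p"
    unfolding pq using l m(1) ml by (simp add: cscalar_prod_linear[where n = n])
  moreover have "((A *\<^sub>v x) \<bullet>c m) \<cdot>\<^sub>v m = q \<cdot>\<^sub>v m"
    unfolding pq using l m lm by (auto simp: cscalar_prod_linear[where n = n])
  ultimately show "A *\<^sub>v x = ((A *\<^sub>v x) \<bullet>c l) \<cdot>\<^sub>v l + ((A *\<^sub>v x) \<bullet>c m) \<cdot>\<^sub>v m"
    using pq by simp
qed

text \<open>
As \<open>B\<close> and \<open>B\<^sup>*\<close> kill \<open>l\<close>, only the component along \<open>m\<close> survives between the two factors:
\<open>A B = u v\<^sup>*\<close> and \<open>B A = w z\<^sup>*\<close> with \<open>u = A m\<close>, \<open>v = B\<^sup>* m\<close>, \<open>w = B m\<close>, \<open>z = A\<^sup>* m\<close>. By normality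
\<open>u, z\<close> vanish together, as do \<open>v, w\<close>, and if one of them vanishes both products are zero.
Otherwise put \<open>\<alpha> = \<langle>A m, m\<rangle>\<close>. Both products have trace \<open>\<alpha> \<langle>B m, m\<rangle>\<close>.

If \<open>\<alpha> \<noteq> 0\<close>, up to similarity the compression \<open>\<alpha> m m\<^sup>*\<close> can replace \<open>A\<close> in both products, and \<open>m\<close> is not in the
kernel of \<open>B\<close>. If \<open>\<alpha> = 0\<close>, then \<open>u\<close> is a multiple of \<open>l\<close> and hence orthogonal to \<open>w\<close>, and
\<open>u v\<^sup>* \<sim> u w\<^sup>* \<sim> (t u) w\<^sup>* \<sim> w (t u)\<^sup>* \<sim> w z\<^sup>*\<close>, where \<open>t\<close> gives \<open>t u\<close> the norm of \<open>w\<close> and the third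
step is a reflection.
\<close>

lemma similar_products_if_orthonormal_range:
  assumes A: "A \<in> carrier_mat n n" and B: "B \<in> carrier_mat n n"
    and nA: "normal_mat A" and nB: "normal_mat B"
    and l: "l \<in> carrier_vec n" "l \<bullet>c l = 1" and m: "m \<in> carrier_vec n" "m = 0\<^sub>v n \<or> m \<bullet>c m = 1"
    and lm: "l \<bullet>c m = 0"
    and range: "\<And>x. x \<in> carrier_vec n \<Longrightarrow> \<exists>p q. A *\<^sub>v x = p \<cdot>\<^sub>v l + q \<cdot>\<^sub>v m"
    and Bl: "B *\<^sub>v l = 0\<^sub>v n"
  shows "similar_mat (A * B) (B * A)"
proof -
  let ?A' = "mat_adjoint A" and ?B' = "mat_adjoint B"
  have Aexp: "A *\<^sub>v x = (x \<bullet>c l) \<cdot>\<^sub>v (A *\<^sub>v l) + (x \<bullet>c m) \<cdot>\<^sub>v (A *\<^sub>v m)"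
    "A *\<^sub>v x = ((A *\<^sub>v x) \<bullet>c l) \<cdot>\<^sub>v l + ((A *\<^sub>v x) \<bullet>c m) \<cdot>\<^sub>v m"
    if "x \<in> carrier_vec n" for x
    using normal_mat_eq_on_orthonormal_pair[OF A nA l m lm _ that] range by blast+
  have A': "?A' \<in> carrier_mat n n" and B': "?B' \<in> carrier_mat n n" using A B by auto
  have B'l: "?B' *\<^sub>v l = 0\<^sub>v n" using normal_mat_kernel[OF B nB l(1)] Bl by blast
  define u v w z where "u = A *\<^sub>v m" and "v = ?B' *\<^sub>v m" and "w = B *\<^sub>v m" and "z = ?A' *\<^sub>v m"
  have u: "u \<in> carrier_vec n" and v: "v \<in> carrier_vec n" and w: "w \<in> carrier_vec n"
    and z: "z \<in> carrier_vec n"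
    using A B A' B' m(1) unfolding u_def v_def w_def z_def
    by (auto intro!: mult_mat_vec_carrier[where nr = n and n = n])
  have lw: "l \<bullet>c w = 0" and lv: "l \<bullet>c v = 0"
    using cscalar_prod_adjoint[OF B' l(1) m(1)] cscalar_prod_adjoint[OF B l(1) m(1)] Bl B'l m(1)
    unfolding w_def v_def by simp_all
  have AB: "A * B = outer_prod n u v"
  proof (rule mat_eq_if_mult_unit_vec_eq[where n = n])
    fix j assume "j < n"
    let ?e = "unit_vec n j :: complex vec"
    have Be: "B *\<^sub>v ?e \<in> carrier_vec n" using B by simp
    have "(B *\<^sub>v ?e) \<bullet>c l = 0" "(B *\<^sub>v ?e) \<bullet>c m = ?e \<bullet>c v"
      using cscalar_prod_adjoint[OF B _ l(1), of ?e] cscalar_prod_adjoint[OF B _ m(1), of ?e] B'l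
      unfolding v_def by simp_all
    then have "A *\<^sub>v (B *\<^sub>v ?e) = 0 \<cdot>\<^sub>v (A *\<^sub>v l) + (?e \<bullet>c v) \<cdot>\<^sub>v u"
      using Aexp(1)[OF Be] unfolding u_def by simp
    then show "(A * B) *\<^sub>v ?e = outer_prod n u v *\<^sub>v ?e"
      using A B l u v by (simp add: outer_prod_mult_vec zero_smult_vec)
  qed (use A B in auto)
  have BA: "B * A = outer_prod n w z"
  proof (rule mat_eq_if_mult_unit_vec_eq[where n = n])
    fix j assume "j < n"
    let ?e = "unit_vec n j :: complex vec"
    have "(A *\<^sub>v ?e) \<bullet>c m = ?e \<bullet>c z"
      using cscalar_prod_adjoint[OF A _ m(1), of ?e] unfolding z_def by simp
    then have "A *\<^sub>v ?e = ((A *\<^sub>v ?e) \<bullet>c l) \<cdot>\<^sub>v l + (?e \<bullet>c z) \<cdot>\<^sub>v m"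
      using Aexp(2)[of ?e] by simp
    then have "B *\<^sub>v (A *\<^sub>v ?e) = B *\<^sub>v (((A *\<^sub>v ?e) \<bullet>c l) \<cdot>\<^sub>v l + (?e \<bullet>c z) \<cdot>\<^sub>v m)" by metis
    also have "\<dots> = B *\<^sub>v (((A *\<^sub>v ?e) \<bullet>c l) \<cdot>\<^sub>v l) + B *\<^sub>v ((?e \<bullet>c z) \<cdot>\<^sub>v m)"
      using B l m by (intro mult_add_distrib_mat_vec[where nr = n and nc = n]) auto
    also have "\<dots> = (?e \<bullet>c z) \<cdot>\<^sub>v w"
      using B l m Bl w by (simp add: mult_mat_vec[where nr = n and nc = n] smult_zero_vec w_def)
    finally show "(B * A) *\<^sub>v ?e = outer_prod n w z *\<^sub>v ?e"
      using A B w z by (simp add: outer_prod_mult_vec)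
  qed (use A B in auto)
  have zero: "outer_prod n x y = 0\<^sub>m n n" if "x = 0\<^sub>v n \<or> y = 0\<^sub>v n" for x y
    using that by (auto simp: outer_prod_def intro!: eq_matI)
  have wv: "w = 0\<^sub>v n \<longleftrightarrow> v = 0\<^sub>v n" and uz: "u = 0\<^sub>v n \<longleftrightarrow> z = 0\<^sub>v n"
    using normal_mat_kernel[OF A nA m(1)] normal_mat_kernel[OF B nB m(1)]
    unfolding u_def v_def w_def z_def by auto
  show ?thesis
  proof (cases "w = 0\<^sub>v n \<or> u = 0\<^sub>v n")
    case True
    then have "A * B = B * A" unfolding AB BA using zero wv uz by metis
    then show ?thesis using similar_mat_refl[of "B * A" n] A B by simp
  next
    case False
    then have nz: "u \<noteq> 0\<^sub>v n" "v \<noteq> 0\<^sub>v n" "w \<noteq> 0\<^sub>v n" "z \<noteq> 0\<^sub>v n" using wv uz by auto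
    define \<alpha> where "\<alpha> = u \<bullet>c m"
    have u_exp: "u = (u \<bullet>c l) \<cdot>\<^sub>v l + \<alpha> \<cdot>\<^sub>v m"
      using Aexp(2)[OF m(1)] unfolding u_def \<alpha>_def .
    have u_inner: "u \<bullet>c y = (u \<bullet>c l) * (l \<bullet>c y) + \<alpha> * (m \<bullet>c y)" if "y \<in> carrier_vec n" for y
      by (subst u_exp) (use that l m in \<open>simp add: cscalar_prod_linear[where n = n]\<close>)
    have wm: "w \<bullet>c m = m \<bullet>c v" unfolding w_def v_def by (rule cscalar_prod_adjoint[OF B m(1) m(1)])
    have uv: "u \<bullet>c v = \<alpha> * (w \<bullet>c m)" using u_inner[OF v] lv wm by simp
    have "A *\<^sub>v w = (m \<bullet>c v) \<cdot>\<^sub>v u"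
      using arg_cong[OF AB, of "\<lambda>X. X *\<^sub>v m"] A B m u v by (simp add: outer_prod_mult_vec w_def)
    \<comment> \<open>The trace \<open>\<langle>w, z\<rangle>\<close> of \<open>B A\<close> equals \<open>\<langle>A B m, m\<rangle>\<close>, which the rank-one form of \<open>A B\<close> evaluates.\<close>
    then have wz: "w \<bullet>c z = \<alpha> * (w \<bullet>c m)"
      using cscalar_prod_adjoint[OF A w m(1)] cscalar_prod_smult_left[OF u m(1)] wm
      unfolding z_def \<alpha>_def by (simp add: mult.commute)
    show ?thesis
    proof (cases "\<alpha> = 0")
      case False
      have m0: "m \<noteq> 0\<^sub>v n" using nz(3) B unfolding w_def by auto
      have \<alpha>m: "\<alpha> \<cdot>\<^sub>v m \<in> carrier_vec n" "\<alpha> \<cdot>\<^sub>v m \<noteq> 0\<^sub>v n"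
        and \<alpha>m': "cnj \<alpha> \<cdot>\<^sub>v m \<in> carrier_vec n" "cnj \<alpha> \<cdot>\<^sub>v m \<noteq> 0\<^sub>v n"
        using m False smult_eq_zero_vec[OF _ m0] by auto
      have left: "outer_prod n (\<alpha> \<cdot>\<^sub>v m) v = outer_prod n (\<alpha> \<cdot>\<^sub>v m) m * B"
        unfolding v_def by (rule outer_prod_mult[OF B \<alpha>m(1) m(1), symmetric])
      have right: "outer_prod n w (cnj \<alpha> \<cdot>\<^sub>v m) = B * outer_prod n (\<alpha> \<cdot>\<^sub>v m) m"
        unfolding outer_prod_smult[OF m(1) m(1)] w_def
        by (rule mult_outer_prod[OF B m(1) \<alpha>m'(1), symmetric])
      have "similar_mat (outer_prod n u v) (outer_prod n (\<alpha> \<cdot>\<^sub>v m) m * B)"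
        unfolding left[symmetric]
        by (rule similar_outer_prod_left[OF u nz(1) \<alpha>m v])
           (simp add: cscalar_prod_smult_left[OF m(1) v] uv wm)
      also have "similar_mat \<dots> (B * outer_prod n (\<alpha> \<cdot>\<^sub>v m) m)"
        using similar_products_outer_prod[OF B nB m(1)] nz(3) unfolding w_def by simp
      also (similar_mat_trans) have "similar_mat \<dots> (outer_prod n w z)"
        unfolding right[symmetric]
        by (rule similar_outer_prod_right[OF \<alpha>m' z nz(4) w])
           (simp add: cscalar_prod_smult_right[OF w m(1)] wz)
      finally (similar_mat_trans) show ?thesis unfolding AB BA .
    next
      case True
      have uw: "u \<bullet>c w = 0" using u_inner[OF w] True lw by simp
      obtain t where t: "t \<noteq> 0" "(t \<cdot>\<^sub>v u) \<bullet>c (t \<cdot>\<^sub>v u) = complex_of_real (Re (w \<bullet>c w))"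
        by (rule scale_to_norm[OF u nz(1) cscalar_prod_self_pos[OF w nz(3)]])
      have tu: "t \<cdot>\<^sub>v u \<in> carrier_vec n" using u by simp
      have norm: "(t \<cdot>\<^sub>v u) \<bullet>c (t \<cdot>\<^sub>v u) = w \<bullet>c w"
        using t(2) cscalar_prod_self_of_real(1)[OF w] by simp
      then have tu0: "t \<cdot>\<^sub>v u \<noteq> 0\<^sub>v n"
        using conjugate_square_eq_0_vec[OF w] conjugate_square_eq_0_vec[OF tu] nz(3) by metis
      have tuw: "(t \<cdot>\<^sub>v u) \<bullet>c w = 0" using cscalar_prod_smult_left[OF u w] uw by simp
      have wtu: "w \<bullet>c (t \<cdot>\<^sub>v u) = 0" using cscalar_prod_commute[OF tu w] tuw by simp
      have "similar_mat (outer_prod n u v) (outer_prod n u w)"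
        by (rule similar_outer_prod_right[OF v nz(2) w nz(3) u]) (simp add: uv uw True)
      also have "similar_mat \<dots> (outer_prod n (t \<cdot>\<^sub>v u) w)"
        by (rule similar_outer_prod_left[OF u nz(1) tu tu0 w]) (simp only: uw tuw)
      also (similar_mat_trans) have "similar_mat \<dots> (outer_prod n w (t \<cdot>\<^sub>v u))"
        by (rule similar_outer_prod_swap[OF tu tu0 w tuw norm])
      also (similar_mat_trans) have "similar_mat \<dots> (outer_prod n w z)"
        by (rule similar_outer_prod_right[OF tu tu0 z nz(4) w]) (simp only: wtu wz True mult_zero_left)
      finally (similar_mat_trans) show ?thesis unfolding AB BA .
    qed
  qed
qed

section \<open>Similarity of the two products\<close>

theorem proposition5p1:
  fixes A B :: "complex mat" and n :: nat
  assumes "A \<in> carrier_mat n n" and "B \<in> carrier_mat n n"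
    and "normal_mat A" and "normal_mat B"
    and "vec_space.rank n A \<le> 2"
  shows "similar_mat (A * B) (B * A)"
proof -
  note A = assms(1) and B = assms(2) and nA = assms(3) and nB = assms(4)
  obtain s1 s2 where s: "s1 \<in> carrier_vec n" "s2 \<in> carrier_vec n"
    and ran: "\<And>x. x \<in> carrier_vec n \<Longrightarrow> \<exists>a b. A *\<^sub>v x = a \<cdot>\<^sub>v s1 + b \<cdot>\<^sub>v s2"
    using rank_le_2_range[OF A assms(5)] by blast
  obtain E where E: "orth_proj n E" and Es: "E *\<^sub>v s1 = 0\<^sub>v n" "E *\<^sub>v s2 = 0\<^sub>v n"
    and kerE: "\<And>x. \<lbrakk>x \<in> carrier_vec n; E *\<^sub>v x = 0\<^sub>v n\<rbrakk> \<Longrightarrow> \<exists>a b. x = a \<cdot>\<^sub>v s1 + b \<cdot>\<^sub>v s2"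
    using orth_proj_onto_complement_pair[OF s] by blast
  note Em = orth_projD(1)[OF E]
  have EA: "E *\<^sub>v (A *\<^sub>v x) = 0\<^sub>v n" if x: "x \<in> carrier_vec n" for x
  proof -
    obtain a b where ab: "A *\<^sub>v x = a \<cdot>\<^sub>v s1 + b \<cdot>\<^sub>v s2" using ran[OF x] by blast
    have "E *\<^sub>v (A *\<^sub>v x) = E *\<^sub>v (a \<cdot>\<^sub>v s1) + E *\<^sub>v (b \<cdot>\<^sub>v s2)"
      unfolding ab using Em s by (intro mult_add_distrib_mat_vec[where nr = n and nc = n]) auto
    then show ?thesis
      using Em s Es by (simp add: mult_mat_vec[where nr = n and nc = n] smult_zero_vec)
  qed
  show ?thesis
    \<comment> \<open>The kernel of \<open>E\<close> is the span of \<open>s1\<close> and \<open>s2\<close>; it stands for the range of \<open>A\<close>.\<close>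
  proof (cases "\<exists>x \<in> carrier_vec n. E *\<^sub>v x = 0\<^sub>v n \<and> B *\<^sub>v x = 0\<^sub>v n \<and> x \<noteq> 0\<^sub>v n")
    case False
    then show ?thesis
      using similar_products_if_range_meets_kernel_trivially[OF A B nB E EA
          orth_proj_normal_annihilates[OF E A nA EA]] by blast
  next
    case True
    then obtain k where k: "k \<in> carrier_vec n" "k \<noteq> 0\<^sub>v n"
      and Ek: "E *\<^sub>v k = 0\<^sub>v n" and Bk: "B *\<^sub>v k = 0\<^sub>v n" by blast
    obtain t where t: "t \<noteq> 0" "(t \<cdot>\<^sub>v k) \<bullet>c (t \<cdot>\<^sub>v k) = complex_of_real 1"
      using scale_to_norm[OF k, of 1] by auto
    define l where "l = t \<cdot>\<^sub>v k"
    have l: "l \<in> carrier_vec n" "l \<bullet>c l = 1" using k t(2) by (auto simp: l_def)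
    then have l0: "l \<noteq> 0\<^sub>v n" using conjugate_square_eq_0_vec[OF l(1)] by auto
    have Bl: "B *\<^sub>v l = 0\<^sub>v n" and El: "E *\<^sub>v l = 0\<^sub>v n"
      using B Em k Bk Ek unfolding l_def
      by (simp_all add: mult_mat_vec[where nr = n and nc = n] smult_zero_vec)
    obtain a b where "l = a \<cdot>\<^sub>v s1 + b \<cdot>\<^sub>v s2" using kerE[OF l(1) El] by blast
    then obtain s where s': "s \<in> carrier_vec n"
      "\<And>p q. \<exists>p' q'. p \<cdot>\<^sub>v s1 + q \<cdot>\<^sub>v s2 = p' \<cdot>\<^sub>v l + q' \<cdot>\<^sub>v s"
      using pair_span_exchange[OF s l(1) l0] by blast
    obtain m where m: "m \<in> carrier_vec n" "l \<bullet>c m = 0" "m = 0\<^sub>v n \<or> m \<bullet>c m = 1"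
      "\<And>p q. \<exists>p' q'. p \<cdot>\<^sub>v l + q \<cdot>\<^sub>v s = p' \<cdot>\<^sub>v l + q' \<cdot>\<^sub>v m"
      using orthonormal_pair_containing[OF l s'(1)] by blast
    have "\<exists>p q. A *\<^sub>v x = p \<cdot>\<^sub>v l + q \<cdot>\<^sub>v m" if "x \<in> carrier_vec n" for x
      using ran[OF that] s'(2) m(4) by metis
    then show ?thesis
      using similar_products_if_orthonormal_range[OF A B nA nB l m(1,3,2) _ Bl] by blast
  qed
qed

end
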